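(* A retract of a quasisober space (respectively cut space, weakly sober space) is not always quasisober (respectively a cut space, weakly sober). That is: (i) there exist a quasisober space $X$ and a retract $Y$ of $X$ that is not quasisober; (ii) there exist a cut space $X$ and a retract $Y$ of $X$ that is not a cut space; (iii) there exist a weakly sober space $X$ and a retract $Y$ of $X$ that is not weakly sober.
   Context: For a topological space $X$, the specialization preorder is $x\le y$ iff $x\in\mathrm{cl}\{y\}$; all order-theoretic notions in $X$ refer to it. For $A\subseteq X$, $A^{\uparrow}$ and $A^{\downarrow}$ denote the sets of all upper, respectively lower, bounds of $A$ in $X$, and $A^{\delta}=(A^{\uparrow})^{\downarrow}$ is the cut closure of $A$; $A$ is a cut if $A=A^{\delta}$. Directed sets and irreducible closed sets are nonempty. $X$ is a cut space if $\mathrm{cl}\,D=D^{\delta}$ for every directed subset $D$ of $X$. $X$ is weakly sober if it is $T_0$ and every irreducible closed subset $A$ of $X$ is a cut. $X$ is quasisober if it is $T_0$ and every irreducible closed subset of $X$ equals $D^{\delta}$ for some directed subset $D$ of $X$. A space $Y$ is a retract of $X$ if there are continuous maps $f:X\to Y$ and $g:Y\to X$ with $f\circ g=1_Y$. *)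

theory Defs
  imports "HOL-Analysis.Analysis"
begin

definition spec_le :: "'a topology \<Rightarrow> 'a \<Rightarrow> 'a \<Rightarrow> bool" where
  "spec_le X x y \<longleftrightarrow> x \<in> topspace X \<and> y \<in> topspace X \<and> x \<in> X closure_of {y}"

definition upper_bounds :: "'a topology \<Rightarrow> 'a set \<Rightarrow> 'a set" where
  "upper_bounds X A = {u \<in> topspace X. \<forall>a\<in>A. spec_le X a u}"

definition lower_bounds :: "'a topology \<Rightarrow> 'a set \<Rightarrow> 'a set" where
  "lower_bounds X A = {l \<in> topspace X. \<forall>a\<in>A. spec_le X l a}"

definition cut_closure :: "'a topology \<Rightarrow> 'a set \<Rightarrow> 'a set" where
  "cut_closure X A = lower_bounds X (upper_bounds X A)"

definition is_cut :: "'a topology \<Rightarrow> 'a set \<Rightarrow> bool" where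
  "is_cut X A \<longleftrightarrow> A \<subseteq> topspace X \<and> A = cut_closure X A"

definition directed_in :: "'a topology \<Rightarrow> 'a set \<Rightarrow> bool" where
  "directed_in X D \<longleftrightarrow>
     D \<subseteq> topspace X \<and> D \<noteq> {} \<and>
     (\<forall>x\<in>D. \<forall>y\<in>D. \<exists>z\<in>D. spec_le X x z \<and> spec_le X y z)"

definition irreducible_closedin :: "'a topology \<Rightarrow> 'a set \<Rightarrow> bool" where
  "irreducible_closedin X A \<longleftrightarrow>
     closedin X A \<and> A \<noteq> {} \<and>
     (\<forall>B C. closedin X B \<longrightarrow> closedin X C \<longrightarrow> A = B \<union> C \<longrightarrow> A = B \<or> A = C)"

definition cut_space :: "'a topology \<Rightarrow> bool" where
  "cut_space X \<longleftrightarrow> (\<forall>D. directed_in X D \<longrightarrow> X closure_of D = cut_closure X D)"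

definition weakly_sober_space :: "'a topology \<Rightarrow> bool" where
  "weakly_sober_space X \<longleftrightarrow>
     t0_space X \<and> (\<forall>A. irreducible_closedin X A \<longrightarrow> is_cut X A)"

definition quasisober_space :: "'a topology \<Rightarrow> bool" where
  "quasisober_space X \<longleftrightarrow>
     t0_space X \<and>
     (\<forall>A. irreducible_closedin X A \<longrightarrow> (\<exists>D. directed_in X D \<and> A = cut_closure X D))"

text \<open>Retracts in the external sense: the retract need not be a subspace (contrast
  \<^const>\<open>retract_of_space\<close>).\<close>

definition is_retract_of :: "'b topology \<Rightarrow> 'a topology \<Rightarrow> bool" where
  "is_retract_of Y X \<longleftrightarrow> (\<exists>f g. retraction_maps X Y f g)"

end

(* Consider the poset consisting of an infinite chain, two incomparable upper bounds u and v of
   that chain, and a point a whose only strict upper bound is u, with the topology of all upper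
   sets. There the irreducible closed sets are the directed lower sets, and u and v together cut
   the chain out exactly. Sending v to u retracts the space onto the complement of v, in which u is
   the only upper bound of the chain, so that a enters its cut closure. *)

theory Submission
  imports Defs
begin

section \<open>Topologies of upper sets\<close>

text \<open>The carrier is an argument of its own, so that a single relation serves both for a space
  and for its restriction to fewer points.\<close>

definition alexandrov :: "'a set \<Rightarrow> ('a \<Rightarrow> 'a \<Rightarrow> bool) \<Rightarrow> 'a topology" where
  "alexandrov S r = topology (\<lambda>U. U \<subseteq> S \<and> (\<forall>x\<in>U. \<forall>y\<in>S. r x y \<longrightarrow> y \<in> U))"

lemma openin_alexandrov:
  "openin (alexandrov S r) U \<longleftrightarrow> U \<subseteq> S \<and> (\<forall>x\<in>U. \<forall>y\<in>S. r x y \<longrightarrow> y \<in> U)"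
proof -
  have "istopology (\<lambda>U. U \<subseteq> S \<and> (\<forall>x\<in>U. \<forall>y\<in>S. r x y \<longrightarrow> y \<in> U))"
    unfolding istopology_def by blast
  then show ?thesis
    by (simp add: alexandrov_def topology_inverse')
qed

lemma topspace_alexandrov [simp]: "topspace (alexandrov S r) = S"
proof -
  have "openin (alexandrov S r) S"
    by (simp add: openin_alexandrov)
  moreover have "topspace (alexandrov S r) \<subseteq> S"
    using openin_topspace[of "alexandrov S r"] unfolding openin_alexandrov by simp
  ultimately show ?thesis
    using openin_subset by fast
qed

lemma closedin_alexandrov:
  "closedin (alexandrov S r) C \<longleftrightarrow> C \<subseteq> S \<and> (\<forall>y\<in>C. \<forall>x\<in>S. r x y \<longrightarrow> x \<in> C)"
  unfolding closedin_def openin_alexandrov by auto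

lemma continuous_map_alexandrov:
  assumes "\<And>x. x \<in> S \<Longrightarrow> f x \<in> T"
    and "\<And>x y. \<lbrakk>x \<in> S; y \<in> S; r x y\<rbrakk> \<Longrightarrow> q (f x) (f y)"
  shows "continuous_map (alexandrov S r) (alexandrov T q) f"
  unfolding continuous_map_def openin_alexandrov using assms by auto

locale preorder_space =
  fixes S :: "'a set" and r :: "'a \<Rightarrow> 'a \<Rightarrow> bool"
  assumes refl: "x \<in> S \<Longrightarrow> r x x"
    and trans: "\<lbrakk>x \<in> S; y \<in> S; z \<in> S; r x y; r y z\<rbrakk> \<Longrightarrow> r x z"
begin

abbreviation "X \<equiv> alexandrov S r"

lemma closure_of_alexandrov:
  assumes "D \<subseteq> S"
  shows "X closure_of D = {x \<in> S. \<exists>d\<in>D. r x d}"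
proof (rule closure_of_unique)
  show "D \<subseteq> {x \<in> S. \<exists>d\<in>D. r x d}"
    using assms refl by blast
  show "closedin X {x \<in> S. \<exists>d\<in>D. r x d}"
    using assms trans unfolding closedin_alexandrov by blast
next
  fix T
  assume "D \<subseteq> T" "closedin X T"
  then show "{x \<in> S. \<exists>d\<in>D. r x d} \<subseteq> T"
    unfolding closedin_alexandrov by blast
qed

lemma spec_le_alexandrov: "spec_le X x y \<longleftrightarrow> x \<in> S \<and> y \<in> S \<and> r x y"
  unfolding spec_le_def using closure_of_alexandrov[of "{y}"] by auto

lemma directed_in_alexandrov:
  "directed_in X D \<longleftrightarrow> D \<subseteq> S \<and> D \<noteq> {} \<and> (\<forall>x\<in>D. \<forall>y\<in>D. \<exists>z\<in>D. r x z \<and> r y z)"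
  unfolding directed_in_def spec_le_alexandrov by (simp, blast)

lemma cut_closure_alexandrov:
  "cut_closure X D = {l \<in> S. \<forall>u\<in>S. (\<forall>a\<in>D. a \<in> S \<and> r a u) \<longrightarrow> r l u}"
  unfolding cut_closure_def lower_bounds_def upper_bounds_def spec_le_alexandrov by auto

lemma t0_space_alexandrov:
  assumes "\<And>x y. \<lbrakk>x \<in> S; y \<in> S; r x y; r y x\<rbrakk> \<Longrightarrow> x = y"
  shows "t0_space X"
  unfolding t0_space_def
proof (clarsimp)
  fix x y
  assume xy: "x \<in> S" "y \<in> S" "x \<noteq> y"
  have up: "openin X {z \<in> S. r w z}" if "w \<in> S" for w
    using that trans unfolding openin_alexandrov by blast
  have "\<not> r x y \<or> \<not> r y x"
    using assms xy by blast
  then show "\<exists>U. openin X U \<and> (x \<notin> U) = (y \<in> U)"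
    using up[OF xy(1)] up[OF xy(2)] refl xy by blast
qed

text \<open>If x and y had no common upper bound in A, the points of A not above x and those not
  above y would be two closed sets covering A, each proper because it misses x or y. Conversely, if
  x is outside B and y outside C, a common upper bound of them in A lies in neither, as closed sets
  are lower sets.\<close>

lemma irreducible_closedin_alexandrov:
  "irreducible_closedin X A \<longleftrightarrow> closedin X A \<and> directed_in X A"
proof
  assume irr: "irreducible_closedin X A"
  then have A: "A \<subseteq> S" "A \<noteq> {}" and low: "\<And>x y. \<lbrakk>y \<in> A; x \<in> S; r x y\<rbrakk> \<Longrightarrow> x \<in> A"
    unfolding irreducible_closedin_def closedin_alexandrov by auto
  have "\<exists>z\<in>A. r x z \<and> r y z" if xy: "x \<in> A" "y \<in> A" for x y
  proof (rule ccontr)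
    assume no: "\<not> (\<exists>z\<in>A. r x z \<and> r y z)"
    have cl: "closedin X {b \<in> A. \<not> r w b}" if "w \<in> A" for w
      unfolding closedin_alexandrov using A low trans that by blast
    have "A = {b \<in> A. \<not> r x b} \<union> {b \<in> A. \<not> r y b}"
      using no by blast
    then have "A = {b \<in> A. \<not> r x b} \<or> A = {b \<in> A. \<not> r y b}"
      using irr cl xy unfolding irreducible_closedin_def by blast
    then show False
      using xy A refl by blast
  qed
  then show "closedin X A \<and> directed_in X A"
    using irr A unfolding irreducible_closedin_def directed_in_alexandrov by blast
next
  assume "closedin X A \<and> directed_in X A"
  then have A: "closedin X A" "A \<subseteq> S" "A \<noteq> {}"
    and dir: "\<And>x y. \<lbrakk>x \<in> A; y \<in> A\<rbrakk> \<Longrightarrow> \<exists>z\<in>A. r x z \<and> r y z"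
    unfolding directed_in_alexandrov by blast+
  have "A = B \<or> A = C" if BC: "closedin X B" "closedin X C" "A = B \<union> C" for B C
  proof (rule ccontr)
    assume "\<not> (A = B \<or> A = C)"
    then obtain x y where xy: "x \<in> A" "x \<notin> B" "y \<in> A" "y \<notin> C"
      using BC(3) by blast
    obtain z where z: "z \<in> A" "r x z" "r y z"
      using dir xy by blast
    moreover have "x \<in> S" "y \<in> S"
      using xy A(2) by auto
    ultimately have "z \<notin> B" "z \<notin> C"
      using xy BC(1,2) unfolding closedin_alexandrov by auto
    then show False
      using z(1) BC(3) by auto
  qed
  then show "irreducible_closedin X A"
    using A unfolding irreducible_closedin_def by blast
qed

text \<open>The set A is directed and is its own closure, so the cut space property applies to A
  itself. This yields quasisobriety and weak sobriety at once.\<close>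

lemma irreducible_closedin_eq_cut_closure:
  assumes "cut_space X" "irreducible_closedin X A"
  shows "directed_in X A" "A = cut_closure X A"
  using assms closure_of_closedin[of X A]
  unfolding cut_space_def irreducible_closedin_alexandrov by auto

lemma quasisober_space_alexandrov:
  assumes "t0_space X" "cut_space X"
  shows "quasisober_space X"
  unfolding quasisober_space_def
  using assms irreducible_closedin_eq_cut_closure by blast

lemma weakly_sober_space_alexandrov:
  assumes "t0_space X" "cut_space X"
  shows "weakly_sober_space X"
  unfolding weakly_sober_space_def is_cut_def
  using assms irreducible_closedin_eq_cut_closure by (auto simp: directed_in_def)

end

section \<open>The example and its cut space property\<close>

text \<open>The chain is \<open>{3..}\<close>; the points \<open>a\<close>, \<open>u\<close>, \<open>v\<close> are \<open>0\<close>, \<open>1\<close>, \<open>2\<close>.\<close>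

definition chain_le :: "nat \<Rightarrow> nat \<Rightarrow> bool" where
  "chain_le x y \<longleftrightarrow> x = y \<or> (3 \<le> x \<and> x \<le> y) \<or> (y = 1 \<and> x \<noteq> 2) \<or> (y = 2 \<and> 3 \<le> x)"

interpretation chain: preorder_space S chain_le for S
  by unfold_locales (auto simp: chain_le_def)

lemma t0_space_chain: "t0_space (alexandrov S chain_le)"
  by (rule chain.t0_space_alexandrov) (auto simp: chain_le_def)

lemma cut_space_chain: "cut_space (alexandrov UNIV chain_le)"
  unfolding cut_space_def
proof (intro allI impI)
  fix D
  assume "directed_in (alexandrov UNIV chain_le) D"
  then have ne: "D \<noteq> {}" and dir: "\<And>x y. \<lbrakk>x \<in> D; y \<in> D\<rbrakk> \<Longrightarrow> \<exists>z\<in>D. chain_le x z \<and> chain_le y z"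
    unfolding chain.directed_in_alexandrov by blast+
  have tr: "chain_le x z" if "chain_le x y" "chain_le y z" for x y z
    using chain.trans[of x UNIV y z] that by simp
  have "{x. \<exists>d\<in>D. chain_le x d} = {l. \<forall>u. (\<forall>a\<in>D. chain_le a u) \<longrightarrow> chain_le l u}"
    (is "?L = ?R")
  proof
    show "?L \<subseteq> ?R"
      by (auto intro: tr)
  next
    show "?R \<subseteq> ?L"
    \<comment> \<open>A greatest element m of D is an upper bound of D, so everything in
      \<open>?R\<close> is below m. Otherwise D turns out to be cofinal in the chain.\<close>
    proof (cases "\<exists>m\<in>D. \<forall>a\<in>D. chain_le a m")
      case True
      then show ?thesis by auto
    next
      case False
      have step: "\<exists>z\<in>D. chain_le x z \<and> z \<noteq> x" if x: "x \<in> D" for x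
      proof -
        obtain a where a: "a \<in> D" "\<not> chain_le a x"
          using False x by auto
        \<comment> \<open>A common upper bound of x and a cannot be x, since a is not below
          x.\<close>
        with dir[OF x a(1)] show ?thesis by auto
      qed
      have D3: "3 \<le> x" if x: "x \<in> D" for x
      proof (rule ccontr)
        assume "\<not> 3 \<le> x"
        \<comment> \<open>Only 1 lies strictly above 0, and 1 and 2 are maximal, so
          \<open>step\<close> fails at y.\<close>
        then obtain y where y: "y \<in> D" "y = 1 \<or> y = 2"
          using step[OF x] unfolding chain_le_def by force
        then show False
          using step[OF y(1)] unfolding chain_le_def by force
      qed
      have unbdd: "\<exists>d\<in>D. n \<le> d" for n
      proof (induction n)
        case (Suc n)
        then obtain d where d: "d \<in> D" "n \<le> d" by auto
        obtain z where z: "z \<in> D" "chain_le d z" "z \<noteq> d"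
          using step[OF d(1)] by auto
        then have "Suc n \<le> z"
          using d D3[OF z(1)] unfolding chain_le_def by linarith
        with z(1) show ?case ..
      qed (use ne in auto)
      have up: "chain_le d 1" "chain_le d 2" if "d \<in> D" for d
        using D3[OF that] by (auto simp: chain_le_def)
      show ?thesis
      proof
        fix l
        assume "l \<in> ?R"
        then have "chain_le l 1" "chain_le l 2"
          using up by auto
        \<comment> \<open>The bound 2 excludes 0 and 1, and the bound 1 excludes 2.\<close>
        then have "3 \<le> l"
          unfolding chain_le_def by linarith
        then show "l \<in> ?L"
          using unbdd[of l] by (auto simp: chain_le_def)
      qed
    qed
  qed
  then show "alexandrov UNIV chain_le closure_of D = cut_closure (alexandrov UNIV chain_le) D"
    by (simp add: chain.closure_of_alexandrov chain.cut_closure_alexandrov)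
qed

section \<open>The retract and its failures\<close>

text \<open>Moving 2 to 1 preserves the order because 2 is maximal and all points strictly below it
  are also below 1.\<close>

lemma chain_retract: "is_retract_of (alexandrov (- {2}) chain_le) (alexandrov UNIV chain_le)"
proof -
  have "retraction_maps (alexandrov UNIV chain_le) (alexandrov (- {2}) chain_le)
          (\<lambda>x. if x = 2 then 1 else x) (\<lambda>x. x)"
    unfolding retraction_maps_def
    by (intro conjI continuous_map_alexandrov) (auto simp: chain_le_def)
  then show ?thesis
    unfolding is_retract_of_def by blast
qed

lemma irreducible_closedin_chain: "irreducible_closedin (alexandrov (- {2}) chain_le) {3..}"
proof -
  have "\<exists>z\<in>{3..}. chain_le x z \<and> chain_le y z" if "3 \<le> x" "3 \<le> y" for x y
    using that by (intro bexI[of _ "max x y"]) (auto simp: chain_le_def)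
  then show ?thesis
    unfolding chain.irreducible_closedin_alexandrov chain.directed_in_alexandrov
      closedin_alexandrov
    by (auto simp: chain_le_def)
qed

text \<open>To keep 0 out of the cut closure, D needs an upper bound u not above 0. With 2 removed,
  u must lie in the chain, but then the cut closure stays below u and misses \<open>Suc u\<close>.
  Allowing any D inside the chain covers all candidates that quasisobriety admits.\<close>

lemma cut_closure_chain_neq:
  assumes "D \<subseteq> {3..}"
  shows "cut_closure (alexandrov (- {2}) chain_le) D \<noteq> {3..}"
proof
  assume eq: "cut_closure (alexandrov (- {2}) chain_le) D = {3..}"
  then have "0 \<notin> cut_closure (alexandrov (- {2}) chain_le) D"
    by simp
  then obtain u where u: "u \<noteq> 2" "\<forall>a\<in>D. chain_le a u" "\<not> chain_le 0 u"
    unfolding chain.cut_closure_alexandrov by auto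
  then have u3: "3 \<le> u"
    unfolding chain_le_def by linarith
  have "Suc u \<in> cut_closure (alexandrov (- {2}) chain_le) D"
    using eq u3 by simp
  moreover have "\<forall>a\<in>D. a \<in> - {2} \<and> chain_le a u"
    using u assms by auto
  ultimately have "chain_le (Suc u) u"
    using u(1) unfolding chain.cut_closure_alexandrov by simp
  then show False
    using u3 unfolding chain_le_def by linarith
qed

lemma not_cut_space_chain: "\<not> cut_space (alexandrov (- {2}) chain_le)"
  using chain.irreducible_closedin_eq_cut_closure(2)[OF _ irreducible_closedin_chain]
    cut_closure_chain_neq[OF subset_refl] by auto

lemma not_weakly_sober_space_chain: "\<not> weakly_sober_space (alexandrov (- {2}) chain_le)"
  using irreducible_closedin_chain cut_closure_chain_neq[OF subset_refl]
  unfolding weakly_sober_space_def is_cut_def by auto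

lemma not_quasisober_space_chain: "\<not> quasisober_space (alexandrov (- {2}) chain_le)"
proof
  assume "quasisober_space (alexandrov (- {2}) chain_le)"
  then obtain D where D: "directed_in (alexandrov (- {2}) chain_le) D"
      "{3..} = cut_closure (alexandrov (- {2}) chain_le) D"
    using irreducible_closedin_chain unfolding quasisober_space_def by auto
  \<comment> \<open>This inclusion forces D into the chain, where
    \<open>cut_closure_chain_neq\<close> applies.\<close>
  from D(1) have "D \<subseteq> cut_closure (alexandrov (- {2}) chain_le) D"
    unfolding chain.directed_in_alexandrov chain.cut_closure_alexandrov by auto
  with D(2) cut_closure_chain_neq[of D] show False
    by auto
qed

theorem mainTheorem7:
  shows "(\<exists>(X :: nat topology) (Y :: nat topology).
            quasisober_space X \<and> is_retract_of Y X \<and> \<not> quasisober_space Y) \<and>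
         (\<exists>(X :: nat topology) (Y :: nat topology).
            cut_space X \<and> is_retract_of Y X \<and> \<not> cut_space Y) \<and>
         (\<exists>(X :: nat topology) (Y :: nat topology).
            weakly_sober_space X \<and> is_retract_of Y X \<and> \<not> weakly_sober_space Y)"
  using chain.quasisober_space_alexandrov[OF t0_space_chain cut_space_chain]
    chain.weakly_sober_space_alexandrov[OF t0_space_chain cut_space_chain]
    chain_retract cut_space_chain not_cut_space_chain not_quasisober_space_chain
    not_weakly_sober_space_chain
  by (intro conjI exI[of _ "alexandrov UNIV chain_le"] exI[of _ "alexandrov (- {2}) chain_le"])

end
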